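(* Let $(A,+,\times)$ be a finite commutative unitary ring with $A\neq\{0_A\}$, and let $R\subset A$ be a submagma of $(A,+)$, i.e. a subset of $A$ closed under $+$. (i) There are only finitely many irreducible $\lambda$-quiddities over $R$. (ii) Let $\ell_A$ be the maximum size of an irreducible $\lambda$-quiddity over $A$. - If $\mathrm{car}(A)=2$, then $4\le \ell_A\le \frac{|SL_2(A)|}{|A|}+2$. - If $\mathrm{car}(A)\neq 2$, then $\max(4,\mathrm{car}(A))\le \ell_A\le \frac{|SL_2(A)|}{2|A|}+2$.
   Context: For a commutative unitary ring $A$ and $a_1,\dots,a_n\in A$, set $M_n(a_1,\ldots,a_n)=\begin{pmatrix} a_n & -1_A\\ 1_A & 0_A\end{pmatrix}\begin{pmatrix} a_{n-1} & -1_A\\ 1_A & 0_A\end{pmatrix}\cdots\begin{pmatrix} a_1 & -1_A\\ 1_A & 0_A\end{pmatrix}$. Let $R\subset A$. An $n$-tuple $(a_1,\dots,a_n)\in R^n$ ($n\ge1$) is a $\lambda$-quiddity over $R$ (of size $n$) if $M_n(a_1,\dots,a_n)=\epsilon\,\mathrm{Id}$ for some $\epsilon\in\{\pm1_A\}$. For $(a_1,\dots,a_n)\in R^n$ and $(b_1,\dots,b_m)\in R^m$, define $(a_1,\dots,a_n)\oplus(b_1,\dots,b_m)=(a_1+b_m,a_2,\dots,a_{n-1},a_n+b_1,b_2,\dots,b_{m-1})$. Write $(a_1,\dots,a_n)\sim(b_1,\dots,b_n)$ if $(b_1,\dots,b_n)$ is obtained from $(a_1,\dots,a_n)$ or from $(a_n,\dots,a_1)$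 by a cyclic rotation. A $\lambda$-quiddity $(c_1,\dots,c_n)$ over $R$ with $n\ge3$ is reducible if there exist a $\lambda$-quiddity $(b_1,\dots,b_l)$ over $R$ and $(a_1,\dots,a_m)\in R^m$ with $m\ge3$, $l\ge3$ and $(c_1,\dots,c_n)\sim(a_1,\dots,a_m)\oplus(b_1,\dots,b_l)$. A $\lambda$-quiddity is irreducible if it is not reducible; the size-2 solution $(0_A,0_A)$ is never considered irreducible. $\ell_R\in\mathbb{N}\cup\{+\infty\}$ denotes the maximum size of an irreducible $\lambda$-quiddity over $R$. $\mathrm{car}(A)$ denotes the characteristic of $A$. *)

theory Defs
  imports "HOL-Analysis.Analysis"
begin

text \<open>
  Tuples \<open>(a\<^sub>1, \<dots>, a\<^sub>n)\<close> are lists \<open>[a\<^sub>1, \<dots>, a\<^sub>n]\<close>. The ambient ring is the type \<open>'a\<close>.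
\<close>

definition elem_mat :: "'a::comm_ring_1 \<Rightarrow> 'a^2^2" where
  "elem_mat a = vector [vector [a, - 1], vector [1, 0]]"

text \<open>The factors appear in reverse order: the matrix of \<open>a\<^sub>1\<close> is the rightmost one.\<close>

primrec cont_mat :: "'a::comm_ring_1 list \<Rightarrow> 'a^2^2" where
  "cont_mat [] = mat 1"
| "cont_mat (a # as) = cont_mat as ** elem_mat a"

definition quiddity :: "'a::comm_ring_1 set \<Rightarrow> 'a list \<Rightarrow> bool" where
  "quiddity R c \<longleftrightarrow>
     1 \<le> length c \<and> set c \<subseteq> R \<and> (\<exists>\<epsilon>\<in>{1, - 1}. cont_mat c = mat \<epsilon>)"

text \<open>Intended for tuples of size at least two.\<close>

definition tuple_oplus :: "'a::comm_ring_1 list \<Rightarrow> 'a list \<Rightarrow> 'a list" where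
  "tuple_oplus a b =
     [hd a + last b] @ butlast (tl a) @ [last a + hd b] @ butlast (tl b)"

definition dihedral_equiv :: "'a list \<Rightarrow> 'a list \<Rightarrow> bool" where
  "dihedral_equiv a b \<longleftrightarrow> (\<exists>k. b = rotate k a \<or> b = rotate k (rev a))"

definition reducible_quiddity :: "'a::comm_ring_1 set \<Rightarrow> 'a list \<Rightarrow> bool" where
  "reducible_quiddity R c \<longleftrightarrow>
     quiddity R c \<and> 3 \<le> length c \<and>
     (\<exists>a b. quiddity R b \<and> set a \<subseteq> R \<and> 3 \<le> length a \<and> 3 \<le> length b \<and>
            dihedral_equiv c (tuple_oplus a b))"

definition irreducible_quiddity :: "'a::comm_ring_1 set \<Rightarrow> 'a list \<Rightarrow> bool" where
  "irreducible_quiddity R c \<longleftrightarrow>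
     quiddity R c \<and> \<not> reducible_quiddity R c \<and> c \<noteq> [0, 0]"

text \<open>
  In \<^typ>\<open>enat\<close> the supremum of a nonempty set of finite values is its maximum if that exists
  and \<open>\<infinity>\<close> otherwise; it is \<open>0\<close> if there are no irreducible quiddities over \<open>R\<close>.
\<close>

definition max_irred_size :: "'a::comm_ring_1 set \<Rightarrow> enat" where
  "max_irred_size R = (SUP c\<in>{c. irreducible_quiddity R c}. enat (length c))"

definition SL2 :: "('a::comm_ring_1^2^2) set" where
  "SL2 = {M. det M = 1}"

end

theory Submission
  imports Defs
begin

text \<open>
  A quiddity \<open>c\<close> of size \<open>n\<close> is reducible as soon as some block \<open>m\<close> of \<open>c\<close> of length between
  \<open>1\<close> and \<open>n - 3\<close> extends to a quiddity \<open>(x, m, y)\<close>. Over the whole ring such \<open>x\<close> and \<open>y\<close> exist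
  iff the upper left entry of the matrix of \<open>m\<close> is \<open>\<plusminus>1\<close>.

  Let \<open>P\<^sub>i\<close> be the matrix of the prefix of length \<open>i\<close>, for \<open>i \<le> n - 3\<close>. If \<open>P\<^sub>i = P\<^sub>j\<close> with
  \<open>i < j\<close>, the block in between has matrix \<open>Id\<close> and extends by \<open>x = y = 0\<close>; so the size of an
  irreducible quiddity is bounded. Over the whole ring, more is true: the second row of
  \<open>\<epsilon> E(t) P\<^sub>i\<close>, with \<open>E(t)\<close> the elementary matrix of \<open>t\<close>, is \<open>\<epsilon>\<close> times the first row of
  \<open>P\<^sub>i\<close>. A coincidence between two of the matrices \<open>\<epsilon> E(t) P\<^sub>i\<close> thus makes the block in between
  lower unitriangular up to sign, so irreducibility makes \<open>(i, \<epsilon>, t) \<mapsto> \<epsilon> E(t) P\<^sub>i\<close> injective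
  into \<open>SL\<^sub>2\<close>.

  The lower bounds come from the constant quiddities \<open>(0, 0, 0, 0)\<close> and \<open>(2, \<dots>, 2)\<close> of size
  \<open>car(A)\<close>.
\<close>

section \<open>Two-by-two matrices: entries, determinants, cancellation\<close>

lemma mat2_mult_nth:
  fixes M N :: "'a::comm_ring_1^2^2"
  shows "(M ** N) $ i $ j = M $ i $ 1 * N $ 1 $ j + M $ i $ 2 * N $ 2 $ j"
  by (simp add: matrix_matrix_mult_def sum_2)

lemma mat2_eq_iff:
  fixes M N :: "'a^2^2"
  shows "M = N \<longleftrightarrow> M $ 1 $ 1 = N $ 1 $ 1 \<and> M $ 1 $ 2 = N $ 1 $ 2 \<and>
    M $ 2 $ 1 = N $ 2 $ 1 \<and> M $ 2 $ 2 = N $ 2 $ 2"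
  by (auto simp: vec_eq_iff forall_2)

lemma mat_nth: "(mat a :: 'a::zero^'n^'n) $ i $ j = (if i = j then a else 0)"
  by (simp add: mat_def)

lemma elem_mat_nth [simp]:
  "elem_mat a $ 1 $ 1 = a" "elem_mat a $ 1 $ 2 = - 1"
  "elem_mat a $ 2 $ 1 = 1" "elem_mat a $ 2 $ 2 = 0"
  by (simp_all add: elem_mat_def)

lemma det_elem_mat: "det (elem_mat a) = 1"
  by (simp add: det_2)

lemma det_cont_mat: "det (cont_mat xs) = 1"
  by (induction xs) (simp_all add: det_mul det_elem_mat)

lemma cont_mat_append: "cont_mat (xs @ ys) = cont_mat ys ** cont_mat xs"
  by (induction xs) (simp_all add: matrix_mul_assoc)

text \<open>Each elementary matrix has its adjugate as inverse. A one-sided inverse is enough to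
  cancel a common prefix matrix on the right.\<close>

lemma cont_mat_right_inverse: "\<exists>N. cont_mat xs ** N = mat 1"
proof (induction xs)
  case (Cons a xs)
  then obtain N where N: "cont_mat xs ** N = mat 1" by blast
  define F :: "'a^2^2" where "F = vector [vector [0, 1], vector [- 1, a]]"
  have "elem_mat a ** F = mat 1"
    by (simp add: mat2_eq_iff mat2_mult_nth mat_nth F_def)
  then have "cont_mat (a # xs) ** (F ** N) = mat 1"
    by (metis N cont_mat.simps(2) matrix_mul_assoc matrix_mul_rid)
  then show ?case by blast
qed (auto intro: exI[of _ "mat 1"])

lemma cont_mat_cancel_right:
  assumes "M ** cont_mat xs = N ** cont_mat xs"
  shows "M = N"
  by (metis assms cont_mat_right_inverse matrix_mul_assoc matrix_mul_rid)

section \<open>Reducibility from a block that can be completed\<close>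

lemma reducible_quiddityI:
  fixes R :: "'a::comm_ring_1 set"
  assumes c: "quiddity R (pre @ mid @ post)"
    and add: "\<And>u v. u \<in> R \<Longrightarrow> v \<in> R \<Longrightarrow> u + v \<in> R"
    and xy: "- x \<in> R" "- y \<in> R"
    and b: "quiddity R (x # mid @ [y])"
    and len: "mid \<noteq> []" "3 \<le> length pre + length post"
  shows "reducible_quiddity R (pre @ mid @ post)"
proof -
  define q where "q = post @ pre"
  obtain u q' where q1: "q = u # q'" "length q' \<ge> 2"
    using len by (cases q) (auto simp: q_def dest: arg_cong[of _ _ length])
  obtain r v where q2: "q' = r @ [v]" "length r \<ge> 1"
    using q1 by (cases q' rule: rev_cases) auto
  \<comment> \<open>The sum \<open>tuple_oplus\<close> adds \<open>y\<close> to the head and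
    \<open>x\<close> to the last entry; subtracting them beforehand gives back \<open>q\<close>. As
    \<open>R\<close> need not contain negatives, this is where \<open>- x\<close> and
    \<open>- y\<close> in \<open>R\<close> are needed.\<close>
  define a where "a = (u - y) # r @ [v - x]"
  have "rotate (length (pre @ mid)) (pre @ mid @ post) = q @ mid"
    using rotate_append[of "pre @ mid" post] by (simp add: q_def)
  moreover have "tuple_oplus a (x # mid @ [y]) = q @ mid"
    by (simp add: tuple_oplus_def a_def q1 q2 butlast_append)
  ultimately have "dihedral_equiv (pre @ mid @ post) (tuple_oplus a (x # mid @ [y]))"
    unfolding dihedral_equiv_def by metis
  moreover have "set q \<subseteq> R"
    using c by (auto simp: quiddity_def q_def)
  then have "set a \<subseteq> R"
    using add[of u "- y"] add[of v "- x"] xy by (auto simp: a_def q1 q2)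
  moreover have "3 \<le> length a" "3 \<le> length (x # mid @ [y])"
    using q2 len by (cases mid; simp add: a_def)+
  moreover have "3 \<le> length (pre @ mid @ post)"
    using len by simp
  ultimately show ?thesis
    using b c unfolding reducible_quiddity_def by blast
qed

text \<open>Since \<open>j < length c - 2\<close>, at least three entries remain after the block, so
  completing the block between \<open>i\<close> and \<open>j\<close> to a quiddity would make
  \<open>c\<close> reducible.\<close>

lemma irreducible_quiddity_prefixes:
  fixes R :: "'a::comm_ring_1 set"
  assumes c: "irreducible_quiddity R c"
    and add: "\<And>u v. u \<in> R \<Longrightarrow> v \<in> R \<Longrightarrow> u + v \<in> R"
    and ij: "i < j" "j < length c - 2"
  obtains mid where "cont_mat (take j c) = cont_mat mid ** cont_mat (take i c)"
    and "\<And>x y \<epsilon>. \<lbrakk>x \<in> R; y \<in> R; - x \<in> R; - y \<in> R; \<epsilon> \<in> {1, - 1}\<rbrakk>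
      \<Longrightarrow> cont_mat (x # mid @ [y]) \<noteq> mat \<epsilon>"
proof -
  define mid where "mid = take (j - i) (drop i c)"
  have tj: "take j c = take i c @ mid"
    using ij by (metis le_add_diff_inverse less_imp_le mid_def take_add)
  then have c_eq: "take i c @ mid @ drop j c = c"
    by (metis append.assoc append_take_drop_id)
  have q: "quiddity R c" "\<not> reducible_quiddity R c"
    using c by (auto simp: irreducible_quiddity_def)
  have mid: "mid \<noteq> []" "set mid \<subseteq> R"
    using ij q(1) by (auto simp: mid_def quiddity_def dest!: in_set_takeD in_set_dropD)
  show thesis
  proof (rule that[of mid])
    show "cont_mat (take j c) = cont_mat mid ** cont_mat (take i c)"
      by (simp add: tj cont_mat_append)
    fix x y \<epsilon> assume *: "x \<in> R" "y \<in> R" "- x \<in> R" "- y \<in> R" "\<epsilon> \<in> {1, - 1 :: 'a}"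
    show "cont_mat (x # mid @ [y]) \<noteq> mat \<epsilon>"
    proof
      assume "cont_mat (x # mid @ [y]) = mat \<epsilon>"
      then have "quiddity R (x # mid @ [y])"
        using * mid unfolding quiddity_def by auto
      then have "reducible_quiddity R (take i c @ mid @ drop j c)"
        using * mid q ij add by (intro reducible_quiddityI[where x = x and y = y])
          (auto simp: c_eq)
      then show False using q by (simp add: c_eq)
    qed
  qed
qed

section \<open>Finiteness over a submagma\<close>

text \<open>Adding \<open>x\<close> to itself \<open>CHAR('a)\<close> times gives zero and stays in
  \<open>R\<close>. The zero later serves as both end entries of a completed block.\<close>

lemma finite_submagma_zero:
  fixes R :: "'a::{comm_ring_1, finite} set"
  assumes add: "\<And>x y. x \<in> R \<Longrightarrow> y \<in> R \<Longrightarrow> x + y \<in> R" and x: "x \<in> R"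
  shows "0 \<in> R"
proof -
  have "of_nat (Suc k) * x \<in> R" for k
  proof (induction k)
    case (Suc k)
    have "of_nat (Suc (Suc k)) * x = x + of_nat (Suc k) * x"
      by (simp add: algebra_simps)
    then show ?case using add[OF x Suc] by simp
  qed (use x in simp)
  moreover have "CHAR('a) > 0"
    by (simp add: finite_imp_CHAR_pos)
  ultimately have "of_nat CHAR('a) * x \<in> R"
    by (metis Suc_pred)
  then show ?thesis by simp
qed

lemma finite_irreducible_quiddities:
  fixes R :: "'a::{comm_ring_1, finite} set"
  assumes add: "\<And>x y. x \<in> R \<Longrightarrow> y \<in> R \<Longrightarrow> x + y \<in> R"
  shows "finite {c. irreducible_quiddity R c}"
proof -
  have "length c \<le> CARD('a^2^2) + 2" if c: "irreducible_quiddity R c" for c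
  proof -
    have "c \<noteq> []" "set c \<subseteq> R"
      using c by (auto simp: irreducible_quiddity_def quiddity_def)
    then have zero: "0 \<in> R"
      using finite_submagma_zero[of R "hd c"] add hd_in_set by blast
    have "cont_mat (take i c) \<noteq> cont_mat (take j c)" if ij: "i < j" "j < length c - 2" for i j
    proof
      assume eq: "cont_mat (take i c) = cont_mat (take j c)"
      obtain mid where "cont_mat (take j c) = cont_mat mid ** cont_mat (take i c)"
        and mid: "\<And>x y \<epsilon>. \<lbrakk>x \<in> R; y \<in> R; - x \<in> R; - y \<in> R; \<epsilon> \<in> {1, - 1}\<rbrakk>
          \<Longrightarrow> cont_mat (x # mid @ [y]) \<noteq> mat \<epsilon>"
        using irreducible_quiddity_prefixes[OF c add ij] by metis
      then have "cont_mat mid = mat 1"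
        by (metis eq cont_mat_cancel_right matrix_mul_lid)
      \<comment> \<open>The square of \<open>elem_mat 0\<close> is -Id.\<close>
      then have "cont_mat (0 # mid @ [0]) = mat (- 1)"
        by (simp add: cont_mat_append mat2_eq_iff mat2_mult_nth mat_nth)
      then show False
        using mid[of 0 0 "- 1"] zero by simp
    qed
    then have "inj_on (\<lambda>i. cont_mat (take i c)) {..<length c - 2}"
      by (intro linorder_inj_onI) auto
    then have "card {..<length c - 2} \<le> CARD('a^2^2)"
      by (intro card_inj_on_le[where f = "\<lambda>i. cont_mat (take i c)"]) auto
    then show ?thesis by simp
  qed
  then have "{c. irreducible_quiddity R c}
      \<subseteq> {c. set c \<subseteq> UNIV \<and> length c \<le> CARD('a^2^2) + 2}"
    by auto
  then show ?thesis
    by (rule finite_subset) (rule finite_lists_length_le, simp)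
qed

section \<open>Upper bound over the whole ring\<close>

lemma irreducible_quiddity_length_bound:
  fixes c :: "'a::{comm_ring_1, finite} list"
  assumes c: "irreducible_quiddity UNIV c"
  shows "(length c - 2) * (card {1, - 1 :: 'a} * CARD('a)) \<le> card (SL2 :: ('a^2^2) set)"
proof -
  \<comment> \<open>As a set, the signs number one or two according to whether 1 = -1, so both
    characteristic cases are treated at once.\<close>
  define S where "S = {1, - 1 :: 'a}"
  define f where "f = (\<lambda>(i, \<epsilon>, t :: 'a). mat \<epsilon> ** elem_mat t ** cont_mat (take i c))"
  have sq: "\<epsilon> * \<epsilon> = 1" if "\<epsilon> \<in> S" for \<epsilon>
    using that by (auto simp: S_def)
  have neq: "f (i, \<epsilon>, t) \<noteq> f (j, \<delta>, u)"
    if ij: "i < j" "j < length c - 2" and S: "\<epsilon> \<in> S" "\<delta> \<in> S" for i j \<epsilon> \<delta> t u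
  proof
    assume eq: "f (i, \<epsilon>, t) = f (j, \<delta>, u)"
    obtain mid where mid1: "cont_mat (take j c) = cont_mat mid ** cont_mat (take i c)"
      and mid: "\<And>x y \<eta>. \<eta> \<in> S \<Longrightarrow> cont_mat (x # mid @ [y]) \<noteq> mat \<eta>"
      using irreducible_quiddity_prefixes[OF c _ ij] unfolding S_def by (metis UNIV_I)
    define B where "B = cont_mat mid"
    have "mat \<epsilon> ** elem_mat t = mat \<delta> ** elem_mat u ** B"
      using eq mid1 unfolding f_def B_def
      by (metis (no_types, lifting) case_prod_conv cont_mat_cancel_right matrix_mul_assoc)
    then have B: "\<epsilon> = \<delta> * B $ 1 $ 1" "\<delta> * B $ 1 $ 2 = 0" "- \<epsilon> = \<delta> * u * B $ 1 $ 2 - \<delta> * B $ 2 $ 2"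
      by (simp_all add: mat2_eq_iff mat2_mult_nth mat_nth algebra_simps)
    have d: "\<delta> * (\<delta> * z) = z" for z
      using sq[OF \<open>\<delta> \<in> S\<close>] by (simp flip: mult.assoc)
    have B12: "B $ 1 $ 2 = 0" using B(2) d by (metis mult_zero_right)
    have B11: "B $ 1 $ 1 = \<delta> * \<epsilon>" using B(1) d by metis
    have B22: "B $ 2 $ 2 = \<delta> * \<epsilon>" using B(3) d B12 by (simp add: d)
    have "- (\<delta> * \<epsilon>) \<in> S" using S by (auto simp: S_def)
    moreover have e: "\<epsilon> * (\<epsilon> * z) = z" for z
      using sq[OF \<open>\<epsilon> \<in> S\<close>] by (simp flip: mult.assoc)
    \<comment> \<open>With s = \<delta>\<epsilon>, \<open>B\<close> has rows (s, 0) and (b, s). For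
      a last entry y, the completed product has diagonal -s and upper right entry b - ys, which
      vanishes for y = sb because s squared is 1.\<close>
    have "cont_mat (0 # mid @ [\<delta> * \<epsilon> * B $ 2 $ 1]) = mat (- (\<delta> * \<epsilon>))"
      using B12 B11 B22 unfolding B_def
      by (simp add: cont_mat_append mat2_eq_iff mat2_mult_nth mat_nth algebra_simps d e)
    ultimately show False using mid by blast
  qed
  have "inj_on f ({..<length c - 2} \<times> S \<times> UNIV)"
  proof (rule inj_onI, clarify, goal_cases)
    case (1 i \<epsilon> t j \<delta> u)
    then have "i = j"
      using neq[of i j \<epsilon> \<delta> t u] neq[of j i \<delta> \<epsilon> u t] by (metis lessThan_iff linorder_neqE_nat)
    with 1 have "mat \<epsilon> ** elem_mat t = mat \<delta> ** elem_mat u"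
      unfolding f_def by (auto dest: cont_mat_cancel_right)
    \<comment> \<open>These are the lower left and the upper left entries.\<close>
    then have "\<epsilon> = \<delta>" "\<epsilon> * t = \<delta> * u"
      by (auto simp: mat2_eq_iff mat2_mult_nth mat_nth)
    moreover from this have "t = u"
      using sq[of \<epsilon>] 1 by (metis mult.assoc mult_1_left)
    ultimately show ?case using \<open>i = j\<close> by simp
  qed
  moreover have "det (mat \<epsilon> :: 'a^2^2) = 1" if "\<epsilon> \<in> S" for \<epsilon>
    using sq[OF that] by (simp add: det_2 mat_nth)
  then have "f ` ({..<length c - 2} \<times> S \<times> UNIV) \<subseteq> SL2"
    by (auto simp: f_def SL2_def det_mul det_elem_mat det_cont_mat)
  ultimately have "card ({..<length c - 2} \<times> S \<times> (UNIV :: 'a set)) \<le> card (SL2 :: ('a^2^2) set)"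
    by (intro card_inj_on_le[of f]) auto
  then show ?thesis
    by (simp add: card_cartesian_product S_def)
qed

lemma max_irred_size_le:
  "ereal_of_enat (max_irred_size (UNIV :: 'a::{comm_ring_1, finite} set))
    \<le> ereal (real (card (SL2 :: ('a^2^2) set)) / (real (card {1, - 1 :: 'a}) * real CARD('a)) + 2)"
proof -
  define N where "N = card (SL2 :: ('a^2^2) set) div (card {1, - 1 :: 'a} * CARD('a)) + 2"
  have pos: "card {1, - 1 :: 'a} * CARD('a) > 0"
    by (simp add: card_gt_0_iff)
  have "length c \<le> N" if "irreducible_quiddity UNIV c" for c :: "'a list"
  proof -
    have "length c - 2 \<le> card (SL2 :: ('a^2^2) set) div (card {1, - 1 :: 'a} * CARD('a))"
      using irreducible_quiddity_length_bound[OF that] pos by (simp only: less_eq_div_iff_mult_less_eq)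
    then show ?thesis by (simp add: N_def)
  qed
  then have "max_irred_size (UNIV :: 'a set) \<le> enat N"
    unfolding max_irred_size_def by (auto intro: SUP_least)
  then have "ereal_of_enat (max_irred_size (UNIV :: 'a set)) \<le> ereal_of_enat (enat N)"
    by (simp only: ereal_of_enat_le_iff)
  also have "\<dots> = ereal (real N)" by simp
  also have "real N
      \<le> real (card (SL2 :: ('a^2^2) set)) / (real (card {1, - 1 :: 'a}) * real CARD('a)) + 2"
    unfolding N_def using of_nat_div_le_of_nat[where 'a = real, of
        "card (SL2 :: ('a^2^2) set)" "card {1, - 1 :: 'a} * CARD('a)"]
    by simp
  finally show ?thesis by simp
qed

section \<open>Lower bounds from constant quiddities\<close>

text \<open>Rotation and reversal fix a constant tuple, so any summand \<open>b\<close> has a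
  constant middle block. The lower right entry of the matrix of \<open>b\<close> is minus the upper
  left entry of the block's matrix, which would have to be \<plusminus>1.\<close>

lemma irreducible_quiddity_replicateI:
  fixes v :: "'a::comm_ring_1"
  assumes q: "quiddity R (replicate n v)" and n: "3 \<le> n"
    and K: "\<And>k. \<lbrakk>1 \<le> k; k \<le> n - 3\<rbrakk> \<Longrightarrow> cont_mat (replicate k v) $ 1 $ 1 \<notin> {1, - 1}"
  shows "irreducible_quiddity R (replicate n v)"
proof -
  have False if "reducible_quiddity R (replicate n v)"
  proof -
    from that obtain a b where b: "quiddity R b" and len: "3 \<le> length a" "3 \<le> length b"
      and "dihedral_equiv (replicate n v) (tuple_oplus a b)"
      unfolding reducible_quiddity_def by blast
    moreover have "rotate k (replicate n v) = replicate n v" for k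
      by (rule replicate_eqI) auto
    ultimately have eq: "tuple_oplus a b = replicate n v"
      by (auto simp: dihedral_equiv_def)
    define k where "k = length b - 2"
    have "length (tuple_oplus a b) = n" using eq by simp
    \<comment> \<open>The sizes satisfy \<open>n = length a + length b - 2\<close>, hence
      \<open>k = n - length a\<close>.\<close>
    then have k: "1 \<le> k" "k \<le> n - 3"
      using len by (auto simp: k_def tuple_oplus_def)
    have "set (butlast (tl b)) \<subseteq> set (tuple_oplus a b)"
      by (auto simp: tuple_oplus_def)
    then have "butlast (tl b) = replicate k v"
      unfolding eq using len by (intro replicate_eqI) (auto simp: k_def)
    moreover have "b = hd b # butlast (tl b) @ [last b]"
      using len by (cases b) (auto simp: append_butlast_last_id)
    ultimately obtain x y where "b = x # replicate k v @ [y]" by metis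
    with b obtain \<epsilon> where \<epsilon>: "\<epsilon> \<in> {1, - 1}" "cont_mat (x # replicate k v @ [y]) = mat \<epsilon>"
      unfolding quiddity_def by blast
    then have "- cont_mat (replicate k v) $ 1 $ 1 = \<epsilon>"
      by (simp add: cont_mat_append mat2_eq_iff mat2_mult_nth mat_nth algebra_simps)
    then have "cont_mat (replicate k v) $ 1 $ 1 \<in> {1, - 1}"
      using \<epsilon>(1) by (metis insert_iff minus_minus singletonD)
    then show False using K k by blast
  qed
  moreover have "replicate n v \<noteq> [0, 0]"
    using n by (auto dest: arg_cong[of _ _ length])
  ultimately show ?thesis
    using q unfolding irreducible_quiddity_def by blast
qed

text \<open>The matrix \<open>elem_mat 2\<close> is Id + N with N squared equal to 0, so its k-th
  power is Id + kN.\<close>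

lemma cont_mat_replicate_2:
  "cont_mat (replicate k 2) $ 1 $ 1 = (of_nat k + 1 :: 'a::comm_ring_1)"
  "cont_mat (replicate k 2) $ 1 $ 2 = (- of_nat k :: 'a)"
  "cont_mat (replicate k 2) $ 2 $ 1 = (of_nat k :: 'a)"
  "cont_mat (replicate k 2) $ 2 $ 2 = (1 - of_nat k :: 'a)"
  by (induction k) (simp_all add: mat2_mult_nth mat_nth algebra_simps)

lemma irreducible_quiddity_zeros:
  "irreducible_quiddity UNIV (replicate 4 (0 :: 'a::comm_ring_1))"
proof (rule irreducible_quiddity_replicateI)
  show "quiddity UNIV (replicate 4 (0 :: 'a))"
    by (auto simp: quiddity_def numeral_eq_Suc mat2_eq_iff mat2_mult_nth mat_nth)
  fix k :: nat assume "1 \<le> k" "k \<le> 4 - 3"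
  then have "k = 1" by simp
  then show "cont_mat (replicate k 0) $ 1 $ 1 \<notin> {1, - 1 :: 'a}"
    by simp
qed simp

lemma irreducible_quiddity_twos:
  assumes "3 \<le> CHAR('a)"
  shows "irreducible_quiddity UNIV (replicate CHAR('a) (2 :: 'a::comm_ring_1))"
proof (rule irreducible_quiddity_replicateI)
  have "cont_mat (replicate CHAR('a) 2) = (mat 1 :: 'a^2^2)"
    by (simp add: mat2_eq_iff cont_mat_replicate_2 mat_nth)
  then show "quiddity UNIV (replicate CHAR('a) (2 :: 'a))"
    using assms by (auto simp: quiddity_def)
  fix k assume k: "1 \<le> k" "k \<le> CHAR('a) - 3"
  \<comment> \<open>The upper left entry k + 1 equals 1 or -1 only if k or k + 2 vanishes in the
    ring; both lie strictly between 0 and the characteristic.\<close>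
  have "of_nat k \<noteq> (0 :: 'a)" "of_nat (k + 2) \<noteq> (0 :: 'a)"
    using k assms by (auto simp only: of_nat_eq_0_iff_char_dvd dest!: dvd_imp_le)
  then show "cont_mat (replicate k 2) $ 1 $ 1 \<notin> {1, - 1 :: 'a}"
    by (auto simp: cont_mat_replicate_2 eq_neg_iff_add_eq_0 algebra_simps)
qed (use assms in simp)

lemma length_le_max_irred_size:
  "irreducible_quiddity R c \<Longrightarrow> enat (length c) \<le> max_irred_size R"
  unfolding max_irred_size_def by (auto intro: SUP_upper)

lemma four_le_max_irred_size: "4 \<le> max_irred_size (UNIV :: 'a::comm_ring_1 set)"
  using length_le_max_irred_size[OF irreducible_quiddity_zeros]
  by (simp add: numeral_eq_enat)

lemma one_eq_minus_one_iff_CHAR: "(1 :: 'a::comm_ring_1) = - 1 \<longleftrightarrow> CHAR('a) = 2"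
proof -
  have "(1 :: 'a) = - 1 \<longleftrightarrow> of_nat 2 = (0 :: 'a)"
    by (simp add: eq_neg_iff_add_eq_0)
  also have "\<dots> \<longleftrightarrow> CHAR('a) dvd 2"
    by (rule of_nat_eq_0_iff_char_dvd)
  also have "\<dots> \<longleftrightarrow> CHAR('a) = 2"
    \<comment> \<open>The other divisor of 2, characteristic 1, cannot occur because 0 and 1 differ
      in \<open>'a\<close>.\<close>
    using two_is_prime_nat by (auto simp: prime_nat_iff)
  finally show ?thesis .
qed

theorem theorem1p1:
  fixes R :: "'a::{comm_ring_1, finite} set"
  assumes "\<And>x y. x \<in> R \<Longrightarrow> y \<in> R \<Longrightarrow> x + y \<in> R"
  shows "finite {c. irreducible_quiddity R c} \<and>
    (CHAR('a) = 2 \<longrightarrow>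
       4 \<le> max_irred_size (UNIV :: 'a set) \<and>
       ereal_of_enat (max_irred_size (UNIV :: 'a set))
         \<le> ereal (real (card (SL2 :: ('a^2^2) set)) / real CARD('a) + 2)) \<and>
    (CHAR('a) \<noteq> 2 \<longrightarrow>
       enat (max 4 CHAR('a)) \<le> max_irred_size (UNIV :: 'a set) \<and>
       ereal_of_enat (max_irred_size (UNIV :: 'a set))
         \<le> ereal (real (card (SL2 :: ('a^2^2) set)) / (2 * real CARD('a)) + 2))"
proof (intro conjI impI)
  show "finite {c. irreducible_quiddity R c}"
    using assms by (rule finite_irreducible_quiddities)
  show "4 \<le> max_irred_size (UNIV :: 'a set)"
    by (rule four_le_max_irred_size)
  show "enat (max 4 CHAR('a)) \<le> max_irred_size (UNIV :: 'a set)"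
  proof (cases "CHAR('a) \<le> 4")
    case True
    then show ?thesis
      using four_le_max_irred_size[where 'a = 'a] by (simp add: max_def numeral_eq_enat)
  next
    case False
    then show ?thesis
      using length_le_max_irred_size[OF irreducible_quiddity_twos[where 'a = 'a]] by simp
  qed
  note upper = max_irred_size_le[where 'a = 'a]
  show "ereal_of_enat (max_irred_size (UNIV :: 'a set))
      \<le> ereal (real (card (SL2 :: ('a^2^2) set)) / real CARD('a) + 2)" if "CHAR('a) = 2"
  proof -
    have "- 1 = (1 :: 'a)"
      using one_eq_minus_one_iff_CHAR[where 'a = 'a] that by metis
    then have "card {1, - 1 :: 'a} = 1"
      by (simp only: insert_absorb2) simp
    then show ?thesis using upper by simp
  qed
  show "ereal_of_enat (max_irred_size (UNIV :: 'a set))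
      \<le> ereal (real (card (SL2 :: ('a^2^2) set)) / (2 * real CARD('a)) + 2)" if "CHAR('a) \<noteq> 2"
  proof -
    have "card {1, - 1 :: 'a} = 2"
      using one_eq_minus_one_iff_CHAR[where 'a = 'a] that by simp
    then show ?thesis using upper by simp
  qed
qed

end
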